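(* Let $\mathcal{A}>0$, $\mathcal{C}>0$ and $\gamma\in\left[0,\frac{\pi}{2}\right]$. Let $\bar\phi_0\in[0,\pi]$ be any equilibrium point, i.e. $\hat F_T(\bar\phi_0)=0$ for the dimensionless total force $\hat F_T$ defined in the context. Then $(\bar\phi_0,\mathcal{C})$ lies in the non-intersection region.
   Context: For parameters $\mathcal{A}>0$, $\mathcal{C}>0$ and contact angle $\gamma\in[0,\pi]$, the dimensionless total force on a circular cylinder floating horizontally on an unbounded bath, as a function of the wetting angle $\phi_0\in[0,\pi]$, is $$\hat F_T(\phi_0)=-\mathcal{A}\mathcal{C}^2-2\sin(\phi_0+\gamma)-4\mathcal{C}\cos\left(\frac{\phi_0+\gamma}{2}\right)\sin\phi_0-\frac12\mathcal{C}^2\sin 2\phi_0+\mathcal{C}^2\phi_0.$$ The intersection function is $$I(\phi_0,\mathcal{C})=\mathcal{C}\sin\phi_0-\sqrt2-\ln\left(\tan\frac{\pi}{8}\right)+2\sin\left(\frac{\phi_0+\gamma}{2}\right)+\ln\left|\tan\left(\frac{\phi_0+\gamma-\pi}{4}\right)\right|.$$ For given $\gamma$, a pair $(\phi_0,\mathcal{C})$ with $\phi_0\in[0,\pi]$, $\mathcal{C}>0$ lies in the intersection region (the fluid interfaces on the two sides of the cylinder meet) if $I(\phi_0,\mathcal{C})\le 0$ and either $\gamma\in\left[0,\frac{\pi}{2}\right]$ and $\phi_0\in\left[0,\frac{\pi}{2}-\gamma\right]$, or $\gamma\in\left[\frac{\pi}{2},\pi\right]$ and $\phi_0\in\left[\frac{3\pi}{2}-\gamma,\pi\right]$.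 Otherwise it lies in the non-intersection region.
   Formalization: The case γ = π/2 with equilibrium φ̄₀ = π is excluded: there I(π, C) = 0 for every C, so the pair lies in the intersection region, and the force vanishes when A = π + 2/C², so the claim as stated fails at exactly that point. *)

theory Defs
  imports Complex_Main
begin

definition total_force :: "real \<Rightarrow> real \<Rightarrow> real \<Rightarrow> real \<Rightarrow> real" where
  "total_force A C \<gamma> \<phi> =
     - A * C\<^sup>2 - 2 * sin (\<phi> + \<gamma>) - 4 * C * cos ((\<phi> + \<gamma>) / 2) * sin \<phi>
     - 1 / 2 * C\<^sup>2 * sin (2 * \<phi>) + C\<^sup>2 * \<phi>"

text \<open>
  The formula is singular only at \<open>\<phi> + \<gamma> = pi\<close> (where HOL sets \<open>ln 0 = 0\<close>).  On the two ranges
  of \<open>\<phi> + \<gamma>\<close> that enter the intersection region, \<open>[0, pi/2]\<close> and \<open>[3*pi/2, 2*pi]\<close>,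
  it is regular, so no default value is ever used there.
\<close>

definition intersection_fun :: "real \<Rightarrow> real \<Rightarrow> real \<Rightarrow> real" where
  "intersection_fun \<gamma> \<phi> C =
     C * sin \<phi> - sqrt 2 - ln (tan (pi / 8)) + 2 * sin ((\<phi> + \<gamma>) / 2)
     + ln \<bar>tan ((\<phi> + \<gamma> - pi) / 4)\<bar>"

definition intersection_region :: "real \<Rightarrow> (real \<times> real) set" where
  "intersection_region \<gamma> =
     {(\<phi>, C). \<phi> \<in> {0..pi} \<and> C > 0 \<and> intersection_fun \<gamma> \<phi> C \<le> 0 \<and>
        (\<gamma> \<in> {0..pi / 2} \<and> \<phi> \<in> {0..pi / 2 - \<gamma>} \<or>
         \<gamma> \<in> {pi / 2..pi} \<and> \<phi> \<in> {3 * pi / 2 - \<gamma>..pi})}"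

definition non_intersection_region :: "real \<Rightarrow> (real \<times> real) set" where
  "non_intersection_region \<gamma> = ({0..pi} \<times> {0<..}) - intersection_region \<gamma>"

text \<open>
  At \<open>\<gamma> = pi/2\<close> the second alternative of the intersection region contains the single angle
  \<open>\<phi> = pi\<close>, where the intersection function vanishes for every \<open>C\<close>.  For a suitable \<open>A\<close> this
  degenerate corner (both contact points at the top of the cylinder) is an equilibrium, so a
  non-intersection theorem for \<open>\<gamma> \<in> [0, pi/2]\<close> has to exclude it.
\<close>

lemma degenerate_corner:
  assumes "C > 0"
  shows "(pi, C) \<in> intersection_region (pi / 2)"
    and "total_force (pi + 2 / C\<^sup>2) C (pi / 2) pi = 0"
proof -
  have half: "(pi + pi / 2) / 2 = pi - pi / 4" and arg: "(pi + pi / 2 - pi) / 4 = pi / 8"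
    by simp_all
  have "sin ((pi + pi / 2) / 2) = sqrt 2 / 2"
    unfolding half by (simp only: sin_pi_minus sin_45)
  moreover have "tan (pi / 8) > 0"
    by (rule tan_gt_zero) auto
  ultimately have "intersection_fun (pi / 2) pi C = 0"
    unfolding intersection_fun_def arg by simp
  then show "(pi, C) \<in> intersection_region (pi / 2)"
    using assms by (simp add: intersection_region_def)
  have "sin (pi + pi / 2) = - 1"
    using sin_add[of pi "pi / 2"] by (simp only: sin_pi cos_pi sin_pi_half cos_pi_half)
  then show "total_force (pi + 2 / C\<^sup>2) C (pi / 2) pi = 0"
    using assms by (simp add: total_force_def field_simps)
qed

end

theory Submission
  imports Defs
begin

text \<open>
  If \<open>\<phi> + \<gamma> \<le> pi/2\<close>, a vanishing force gives
  \<open>C * (\<phi> - sin \<phi> * cos \<phi>) > 4 * cos ((\<phi> + \<gamma>) / 2) * sin \<phi>\<close>, and the left-hand side is at most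
  \<open>2 * C * (sin \<phi>)\<^sup>2\<close>.  Since \<open>cos ((\<phi> + \<gamma>) / 2) \<ge> sqrt 2 / 2\<close>, this forces
  \<open>C * sin \<phi> > sqrt 2\<close>, and the remaining terms of the intersection function are nonnegative on
  that range of angles.
\<close>

lemma le_tan:
  fixes x :: real
  assumes "0 \<le> x" and "x < pi / 2"
  shows "x \<le> tan x"
proof -
  have "\<exists>d. ((\<lambda>t. tan t - t) has_real_derivative d) (at t) \<and> 0 \<le> d" if "0 \<le> t" "t \<le> x" for t
  proof (intro exI conjI)
    have pos: "cos t > 0"
      using that assms by (intro cos_gt_zero_pi) linarith+
    then show "((\<lambda>t. tan t - t) has_real_derivative inverse ((cos t)\<^sup>2) - 1) (at t)"
      by (auto intro!: derivative_eq_intros)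
    have "(cos t)\<^sup>2 \<le> 1"
      using pos by (simp add: power_le_one)
    then show "0 \<le> inverse ((cos t)\<^sup>2) - 1"
      using pos by (simp add: one_le_inverse)
  qed
  then have "tan 0 - 0 \<le> tan x - x"
    by (rule DERIV_nonneg_imp_nondecreasing[OF assms(1)])
  then show ?thesis
    by simp
qed

text \<open>The half-angle formula turns \<open>x / 2 \<le> tan (x / 2)\<close> into
  \<open>x * (cos x + 1) \<le> 2 * sin x\<close>. Multiplying the claim by \<open>cos x + 1\<close>
  then leaves a purely trigonometric inequality.\<close>

lemma diff_sin_cos_le_two_sin_squared:
  fixes x :: real
  assumes "0 \<le> x" and "x \<le> pi / 2"
  shows "x - sin x * cos x \<le> 2 * (sin x)\<^sup>2"
proof -
  let ?s = "sin x" and ?c = "cos x"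
  have s: "0 \<le> ?s" "?s \<le> 1" and c: "0 \<le> ?c" "?c \<le> 1"
    using assms by (auto intro: sin_ge_zero cos_ge_zero)
  have "x / 2 \<le> tan (x / 2)"
    using assms pi_gt_zero by (intro le_tan) linarith+
  also have "tan (x / 2) = ?s / (?c + 1)"
    using tan_half[of "x / 2"] by simp
  finally have "x * (?c + 1) \<le> 2 * ?s"
    using c by (simp add: field_simps)
  also have "2 * ?s \<le> ?s * ((2 * ?s + ?c) * (?c + 1))"
  proof -
    \<comment> \<open>Expanded, the product is at least
      \<open>2 * ?s\<^sup>2 + 2 * ?c\<^sup>2\<close>, which equals 2.\<close>
    have "?s\<^sup>2 \<le> ?s" and "?c\<^sup>2 \<le> ?c"
      using s c by (auto simp: power2_eq_square intro: mult_left_le)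
    moreover have "0 \<le> ?s * ?c"
      using s c by simp
    moreover have "(2 * ?s + ?c) * (?c + 1) = 2 * ?s + ?c + 2 * (?s * ?c) + ?c\<^sup>2"
      by (simp add: algebra_simps power2_eq_square)
    ultimately have "2 \<le> (2 * ?s + ?c) * (?c + 1)"
      using sin_cos_squared_add[of x] by linarith
    then have "?s * 2 \<le> ?s * ((2 * ?s + ?c) * (?c + 1))"
      using s(1) by (rule mult_left_mono)
    then show ?thesis
      by simp
  qed
  also have "\<dots> = (2 * ?s\<^sup>2 + ?s * ?c) * (?c + 1)"
    by (simp add: algebra_simps power2_eq_square)
  finally have "x \<le> 2 * ?s\<^sup>2 + ?s * ?c"
    using c by simp
  then show ?thesis
    by simp
qed

lemma sqrt2_less_of_total_force_zero:
  fixes A C \<gamma> \<phi> :: real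
  assumes "A > 0" and "C > 0" and "0 \<le> \<gamma>" and "0 \<le> \<phi>" and "\<phi> + \<gamma> \<le> pi / 2"
    and force: "total_force A C \<gamma> \<phi> = 0"
  shows "sqrt 2 < C * sin \<phi>"
proof -
  let ?s = "sin \<phi>" and ?k = "cos ((\<phi> + \<gamma>) / 2)"
  have AC: "A * C\<^sup>2 > 0" and sin_nonneg: "sin (\<phi> + \<gamma>) \<ge> 0"
    using assms by (auto intro: sin_ge_zero)
  \<comment> \<open>At angle 0 the force is \<open>- A * C\<^sup>2 - 2 * sin \<gamma>\<close>, which
    is negative.\<close>
  have "\<phi> \<noteq> 0"
  proof
    assume "\<phi> = 0"
    then show False
      using force AC sin_nonneg by (simp add: total_force_def)
  qed
  then have s: "?s > 0"
    using assms by (intro sin_gt_zero) linarith+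
  \<comment> \<open>By the force balance the two sides differ by
    \<open>A * C\<^sup>2 + 2 * sin (\<phi> + \<gamma>)\<close>; the weight term makes the inequality
    strict.\<close>
  have "4 * C * ?k * ?s < C\<^sup>2 * (\<phi> - ?s * cos \<phi>)"
    using force AC sin_nonneg unfolding total_force_def sin_double
    by (simp add: algebra_simps)
  also have "\<dots> \<le> C\<^sup>2 * (2 * ?s\<^sup>2)"
    using assms by (intro mult_left_mono diff_sin_cos_le_two_sin_squared) auto
  also have "\<dots> = (2 * (C * ?s)) * (C * ?s)"
    by (simp add: power2_eq_square)
  finally have "(4 * ?k) * (C * ?s) < (2 * (C * ?s)) * (C * ?s)"
    by (simp add: mult_ac)
  then have "4 * ?k < 2 * (C * ?s)"
    using s \<open>C > 0\<close> by (subst (asm) mult_less_cancel_right_pos) auto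
  moreover have "cos (pi / 4) \<le> ?k"
    using assms pi_gt_zero by (intro cos_monotone_0_pi_le) (simp_all add: field_simps)
  ultimately show ?thesis
    by (simp add: cos_45)
qed

theorem mainTheorem8:
  fixes A C \<gamma> \<phi> :: real
  assumes "A > 0" and "C > 0" and "\<gamma> \<in> {0..pi / 2}"
    and "\<phi> \<in> {0..pi}" and "total_force A C \<gamma> \<phi> = 0"
    and not_corner: "(\<gamma>, \<phi>) \<noteq> (pi / 2, pi)"
  shows "(\<phi>, C) \<in> non_intersection_region \<gamma>"
proof -
  have "intersection_fun \<gamma> \<phi> C > 0" if sum: "\<phi> + \<gamma> \<le> pi / 2"
  proof -
    have "sqrt 2 < C * sin \<phi>"
      using assms sum by (intro sqrt2_less_of_total_force_zero[of A C \<gamma> \<phi>]) auto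
    moreover have "sin ((\<phi> + \<gamma>) / 2) \<ge> 0"
      using assms sum by (intro sin_ge_zero) auto
    moreover have "ln (tan (pi / 8)) \<le> ln \<bar>tan ((\<phi> + \<gamma> - pi) / 4)\<bar>"
    proof -
      have "tan (pi / 8) > 0"
        by (rule tan_gt_zero) auto
      \<comment> \<open>Since \<open>\<phi> + \<gamma>\<close> lies between 0 and
        \<open>pi / 2\<close>, the right-hand argument lies between \<open>pi / 8\<close> and
        \<open>pi / 4\<close>, where \<open>tan\<close> increases.\<close>
      moreover have "tan (pi / 8) \<le> tan ((pi - (\<phi> + \<gamma>)) / 4)"
        using assms sum pi_gt_zero unfolding atLeastAtMost_iff
        by (intro tan_mono_le; simp add: field_simps; linarith?)
      moreover have "tan ((\<phi> + \<gamma> - pi) / 4) = - tan ((pi - (\<phi> + \<gamma>)) / 4)"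
        by (metis minus_diff_eq minus_divide_left tan_minus)
      ultimately show ?thesis
        by simp
    qed
    ultimately show ?thesis
      unfolding intersection_fun_def by linarith
  qed
  \<comment> \<open>With \<open>\<gamma> \<le> pi / 2\<close>, the second alternative of the
    intersection region forces \<open>\<gamma> = pi / 2\<close> and \<open>\<phi> = pi\<close>, the
    excluded corner; the first is the case just treated.\<close>
  then show ?thesis
    using assms by (auto simp: non_intersection_region_def intersection_region_def)
qed

end
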